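(* Consider $\mathsf{maxQPE}_{N,\delta}$ with advice given as at most $t$ applications of an advice unitary (and its inverse) preparing a state of overlap at least $\gamma$, where $N\ge2$, $\gamma\in[1/\sqrt N,1]$, $\delta\in(0,1)$ and $t=o(1/\gamma)$. Then every algorithm solving this task in the known-eigenbasis case (and hence also every algorithm solving it in the unknown-eigenbasis case) has cost $\Omega(\sqrt N/\delta)$. Precisely: for every sequence of parameters $(N_n,\gamma_n,\delta_n,t_n)_{n\ge1}$ satisfying these constraints with $t_n\ge0$ integers and $t_n\gamma_n\to0$, there exist $c>0$ and $n_0$ such that for all $n\ge n_0$ every such algorithm has cost at least $c\sqrt{N_n}/\delta_n$.
   Context: Model of computation. The input is an unknown $N$-dimensional unitary $U$. The state space is $\mathbb{C}^N\otimes W$, where the first register is $N$-dimensional with computational basis $|0\rangle,\dots,|N-1\rangle$ and $W$ is an arbitrarily large (finite-dimensional) workspace. The algorithm starts in $|0\rangle|0\rangle$; it may apply $U$ and $U^{-1}$ to the first register (possibly controlled by a qubit of the workspace), and arbitrary unitaries independent of $U$ to the whole space, and it may use the advice unitary as described below; at the end it performs a POVM (independent of $U$) which determines the classical output. The cost of the algorithm is the total number of applications of $U$ and $U^{-1}$ (including controlled versions); all other operations, including uses of the advice unitary, do not count towards the cost. The task $\mathsf{maxQPE}_{N,\delta}$ with $t$ accesses to an advice unitary of overlap at least $\gamma$. Let $U=\sum_{j=0}^{N-1}e^{i\theta_j}|u_j\rangle\langle u_j|$ with orthonormal eigenbasis $(|u_j\rangle)$ and $\theta_j\in[0,2\pi)$,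 let $\theta_{\max}=\max_j\theta_j$, and let $S$ be the span of all eigenstates with eigenphase $\theta_{\max}$. Input promise: $\theta_{\max}\in[0,2\pi-2\delta)$. In the known-eigenbasis case $U$ is moreover promised to be diagonal in the computational basis ($|u_j\rangle=|j\rangle$); in the unknown-eigenbasis case the eigenbasis is arbitrary and unknown. Advice: the algorithm has black-box access to a unitary $A$ with $A|0\rangle=|\alpha\rangle$, where $\|P_S|\alpha\rangle\|^2\ge\gamma^2$ and $P_S$ is the orthogonal projection onto $S$; it may apply $A$ and $A^{-1}$ at most $t$ times in total. Output: with probability at least $2/3$, a value in $[\theta_{\max}-\delta,\theta_{\max}+\delta]$ modulo $2\pi$. The algorithm (which may depend on $N,\delta,\gamma,t$) must be correct for every $U$ satisfying the promise and every valid $A$. *)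

theory Defs
  imports Complex_Main "Jordan_Normal_Form.Schur_Decomposition"
begin

definition unitary_mat :: "nat \<Rightarrow> complex mat \<Rightarrow> bool" where
  "unitary_mat n U \<longleftrightarrow> U \<in> carrier_mat n n \<and>
     mat_adjoint U * U = 1\<^sub>m n \<and> U * mat_adjoint U = 1\<^sub>m n"

text \<open>Positive semidefiniteness. The order on the complex numbers is the one in which
  \<open>0 \<le> z\<close> says that \<open>z\<close> is real and nonnegative, so this forces \<open>E\<close> to be Hermitian.\<close>

definition psd_mat :: "nat \<Rightarrow> complex mat \<Rightarrow> bool" where
  "psd_mat n E \<longleftrightarrow> E \<in> carrier_mat n n \<and> (\<forall>v \<in> carrier_vec n. 0 \<le> (E *\<^sub>v v) \<bullet>c v)"

definition sqnorm :: "complex vec \<Rightarrow> real" where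
  "sqnorm v = Re (v \<bullet>c v)"

text \<open>Kronecker product: on an \<open>N\<close>-dimensional register tensored with a \<open>d\<close>-dimensional
  workspace, the basis state \<open>|x\<rangle>|w\<rangle>\<close> has index \<open>x * d + w\<close>.\<close>

definition kron :: "complex mat \<Rightarrow> complex mat \<Rightarrow> complex mat" where
  "kron A B = mat (dim_row A * dim_row B) (dim_col A * dim_col B)
     (\<lambda>(i, j). A $$ (i div dim_row B, j div dim_col B) * B $$ (i mod dim_row B, j mod dim_col B))"

text \<open>A POVM with finitely many outcomes, each outcome labelled with the classical output that
  the algorithm returns on it. Labels may repeat.\<close>

type_synonym rpovm = "(real \<times> complex mat) list"

definition valid_povm :: "nat \<Rightarrow> rpovm \<Rightarrow> bool" where
  "valid_povm n M \<longleftrightarrow> (\<forall>(x, E) \<in> set M. psd_mat n E) \<and>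
     foldr (+) (map snd M) (0\<^sub>m n n) = 1\<^sub>m n"

text \<open>In \<open>Query q adj ctl\<close>, the flag \<open>adj\<close> selects the inverse of the black box, and \<open>ctl\<close> is the
  optional control qubit. A \<open>d\<close>-dimensional workspace factors as
  \<open>\<complex>\<^sup>a \<otimes> \<complex>\<^sup>2 \<otimes> \<complex>\<^sup>b\<close> whenever \<open>d = a * 2 * b\<close>; \<open>Some b\<close> denotes the middle factor of this
  decomposition, whose value in the basis state \<open>|w\<rangle>\<close> is the parity of \<open>w div b\<close>.\<close>

datatype blackbox = Input | Advice

datatype gate = Fixed "complex mat" | Query blackbox bool "nat option"

definition valid_gate :: "nat \<Rightarrow> nat \<Rightarrow> gate \<Rightarrow> bool" where
  "valid_gate N d g = (case g of
       Fixed V \<Rightarrow> unitary_mat (N * d) V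
     | Query q adj ctl \<Rightarrow> (case ctl of None \<Rightarrow> True | Some b \<Rightarrow> 2 * b dvd d))"

definition on_register :: "nat \<Rightarrow> nat \<Rightarrow> nat option \<Rightarrow> complex mat \<Rightarrow> complex mat" where
  "on_register N d ctl X = (case ctl of
       None \<Rightarrow> kron X (1\<^sub>m d)
     | Some b \<Rightarrow> kron X (mat_diag d (\<lambda>w. if odd (w div b) then 1 else 0)) +
                 kron (1\<^sub>m N) (mat_diag d (\<lambda>w. if odd (w div b) then 0 else 1)))"

definition gate_mat :: "nat \<Rightarrow> nat \<Rightarrow> complex mat \<Rightarrow> complex mat \<Rightarrow> gate \<Rightarrow> complex mat" where
  "gate_mat N d U A g = (case g of
       Fixed V \<Rightarrow> V
     | Query q adj ctl \<Rightarrow>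
         (let X = (case q of Input \<Rightarrow> U | Advice \<Rightarrow> A)
          in on_register N d ctl (if adj then mat_adjoint X else X)))"

record qalg =
  wdim :: nat
  gates :: "gate list"
  povm :: rpovm

definition query_count :: "blackbox \<Rightarrow> qalg \<Rightarrow> nat" where
  "query_count q alg = length (filter (\<lambda>g. \<exists>adj ctl. g = Query q adj ctl) (gates alg))"

abbreviation cost :: "qalg \<Rightarrow> nat" where
  "cost \<equiv> query_count Input"

definition valid_alg :: "nat \<Rightarrow> nat \<Rightarrow> qalg \<Rightarrow> bool" where
  "valid_alg N t alg \<longleftrightarrow> 0 < wdim alg \<and> (\<forall>g \<in> set (gates alg). valid_gate N (wdim alg) g) \<and>
     valid_povm (N * wdim alg) (povm alg) \<and> query_count Advice alg \<le> t"

text \<open>The first gate of the list is applied first.\<close>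

definition final_state :: "nat \<Rightarrow> qalg \<Rightarrow> complex mat \<Rightarrow> complex mat \<Rightarrow> complex vec" where
  "final_state N alg U A =
     fold (\<lambda>g \<psi>. gate_mat N (wdim alg) U A g *\<^sub>v \<psi>) (gates alg) (unit_vec (N * wdim alg) 0)"

definition output_prob ::
    "nat \<Rightarrow> qalg \<Rightarrow> complex mat \<Rightarrow> complex mat \<Rightarrow> (real \<Rightarrow> bool) \<Rightarrow> real" where
  "output_prob N alg U A P =
     (let \<psi> = final_state N alg U A
      in \<Sum>(x, E) \<leftarrow> filter (\<lambda>(x, E). P x) (povm alg). Re ((E *\<^sub>v \<psi>) \<bullet>c \<psi>))"

text \<open>An eigenbasis is given as the unitary matrix \<open>B\<close> whose \<open>j\<close>-th column is \<open>|u\<^sub>j\<rangle>\<close>; then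
  \<open>\<Sum>\<^sub>j f j |u\<^sub>j\<rangle>\<langle>u\<^sub>j|\<close> is \<open>B\<close> times the diagonal matrix of \<open>f\<close> times the adjoint of \<open>B\<close>.\<close>

definition spectral_mat :: "nat \<Rightarrow> complex mat \<Rightarrow> (nat \<Rightarrow> complex) \<Rightarrow> complex mat" where
  "spectral_mat N B f = B * mat_diag N f * mat_adjoint B"

definition phase_unitary :: "nat \<Rightarrow> complex mat \<Rightarrow> (nat \<Rightarrow> real) \<Rightarrow> complex mat" where
  "phase_unitary N B \<theta> = spectral_mat N B (\<lambda>j. cis (\<theta> j))"

definition max_phase :: "nat \<Rightarrow> (nat \<Rightarrow> real) \<Rightarrow> real" where
  "max_phase N \<theta> = Max (\<theta> ` {..<N})"

text \<open>The orthogonal projection onto the span of all \<open>|u\<^sub>j\<rangle>\<close> with maximal phase.\<close>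

definition max_proj :: "nat \<Rightarrow> complex mat \<Rightarrow> (nat \<Rightarrow> real) \<Rightarrow> complex mat" where
  "max_proj N B \<theta> = spectral_mat N B (\<lambda>j. if \<theta> j = max_phase N \<theta> then 1 else 0)"

definition valid_phases :: "nat \<Rightarrow> real \<Rightarrow> (nat \<Rightarrow> real) \<Rightarrow> bool" where
  "valid_phases N \<delta> \<theta> \<longleftrightarrow> (\<forall>j<N. 0 \<le> \<theta> j \<and> \<theta> j < 2 * pi) \<and>
     0 \<le> max_phase N \<theta> \<and> max_phase N \<theta> < 2 * pi - 2 * \<delta>"

definition valid_advice ::
    "nat \<Rightarrow> real \<Rightarrow> complex mat \<Rightarrow> (nat \<Rightarrow> real) \<Rightarrow> complex mat \<Rightarrow> bool" where
  "valid_advice N \<gamma> B \<theta> A \<longleftrightarrow> unitary_mat N A \<and>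
     \<gamma>\<^sup>2 \<le> sqnorm (max_proj N B \<theta> *\<^sub>v (A *\<^sub>v unit_vec N 0))"

definition approx_mod_2pi :: "real \<Rightarrow> real \<Rightarrow> real \<Rightarrow> bool" where
  "approx_mod_2pi \<delta> \<phi> x \<longleftrightarrow> (\<exists>k::int. x + 2 * pi * of_int k \<in> {\<phi> - \<delta> .. \<phi> + \<delta>})"

definition correct_on ::
    "nat \<Rightarrow> real \<Rightarrow> real \<Rightarrow> qalg \<Rightarrow> complex mat \<Rightarrow> bool" where
  "correct_on N \<delta> \<gamma> alg B \<longleftrightarrow>
     (\<forall>\<theta> A. valid_phases N \<delta> \<theta> \<longrightarrow> valid_advice N \<gamma> B \<theta> A \<longrightarrow>
        2 / 3 \<le> output_prob N alg (phase_unitary N B \<theta>) A (approx_mod_2pi \<delta> (max_phase N \<theta>)))"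

definition solves_maxQPE_known :: "nat \<Rightarrow> real \<Rightarrow> real \<Rightarrow> nat \<Rightarrow> qalg \<Rightarrow> bool" where
  "solves_maxQPE_known N \<delta> \<gamma> t alg \<longleftrightarrow> valid_alg N t alg \<and> correct_on N \<delta> \<gamma> alg (1\<^sub>m N)"

definition solves_maxQPE_unknown :: "nat \<Rightarrow> real \<Rightarrow> real \<Rightarrow> nat \<Rightarrow> qalg \<Rightarrow> bool" where
  "solves_maxQPE_unknown N \<delta> \<gamma> t alg \<longleftrightarrow> valid_alg N t alg \<and>
     (\<forall>B. unitary_mat N B \<longrightarrow> correct_on N \<delta> \<gamma> alg B)"

end

theory Submission
  imports Defs "HOL-Analysis.L2_Norm"
begin

text \<open>
  Hybrid argument. Compare the trivial instance \<open>U = A = I\<close> with the instances in which \<open>U\<close> has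
  phase \<open>3 * \<delta>\<close> on \<open>|j\<rangle>\<close> only, for \<open>0 < j < N\<close>, and \<open>A\<close> is the rotation by the angle
  \<open>arcsin \<gamma>\<close> in the plane of \<open>|0\<rangle>\<close> and \<open>|j\<rangle>\<close>. A query to \<open>U\<close> separates the two runs by at most
  \<open>3 * \<delta>\<close> times the amplitude that the trivial run has on \<open>|j\<rangle>\<close>, and by Cauchy--Schwarz these
  amplitudes sum to at most \<open>sqrt (N - 1)\<close> over \<open>j\<close>; a query to \<open>A\<close> separates them by \<open>O(\<gamma>)\<close>.
  The correct outputs \<open>[-\<delta>, \<delta>]\<close> and \<open>[2 * \<delta>, 4 * \<delta>]\<close> are disjoint modulo \<open>2 * pi\<close> because
  \<open>5 * \<delta> < 2 * pi\<close>, so every pair of final states has to be a constant distance apart, and the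
  \<open>o(1/\<gamma>)\<close> advice queries account for a vanishing part of it.
\<close>

section \<open>Norms and adjoints\<close>

lemma Re_mult_cnj: "Re (z * cnj z) = (cmod z)\<^sup>2"
  by (simp add: complex_mult_cnj cmod_power2)

lemma sqnorm_sum: "sqnorm v = (\<Sum>i<dim_vec v. (cmod (v $ i))\<^sup>2)"
  unfolding sqnorm_def scalar_prod_def
  by (simp add: Re_mult_cnj atLeast0LessThan del: times_complex.sel)

definition vnorm :: "complex vec \<Rightarrow> real" where
  "vnorm v = sqrt (sqnorm v)"

lemma sqnorm_nonneg [simp]: "0 \<le> sqnorm v"
  unfolding sqnorm_sum by (simp add: sum_nonneg)

lemma vnorm_nonneg [simp]: "0 \<le> vnorm v"
  by (simp add: vnorm_def)

lemma vnorm_power2: "(vnorm v)\<^sup>2 = sqnorm v"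
  by (simp add: vnorm_def)

text \<open>Through this identification the triangle inequality and Cauchy--Schwarz for
  \<open>L2_set\<close> become available for vectors.\<close>

lemma vnorm_L2_set: "vnorm v = L2_set (\<lambda>i. cmod (v $ i)) {..<dim_vec v}"
  by (simp add: vnorm_def sqnorm_sum L2_set_def)

lemma vnorm_triangle:
  assumes "v \<in> carrier_vec n" "w \<in> carrier_vec n"
  shows "vnorm (v + w) \<le> vnorm v + vnorm w"
proof -
  have "vnorm (v + w) = L2_set (\<lambda>i. cmod (v $ i + w $ i)) {..<n}"
    using assms by (auto simp: vnorm_L2_set intro!: L2_set_cong)
  also have "\<dots> \<le> L2_set (\<lambda>i. cmod (v $ i) + cmod (w $ i)) {..<n}"
    by (intro L2_set_mono) (auto simp: norm_triangle_ineq)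
  also have "\<dots> \<le> vnorm v + vnorm w"
    using L2_set_triangle_ineq assms by (auto simp: vnorm_L2_set)
  finally show ?thesis .
qed

lemma vnorm_minus_triangle:
  assumes "u \<in> carrier_vec n" "v \<in> carrier_vec n" "w \<in> carrier_vec n"
  shows "vnorm (u - w) \<le> vnorm (u - v) + vnorm (v - w)"
proof -
  have "u - w = (u - v) + (v - w)"
    using assms by (intro eq_vecI) auto
  then show ?thesis
    using assms by (metis vnorm_triangle minus_carrier_vec)
qed

section \<open>Adjoints and unitary matrices\<close>

lemma dim_mat_adjoint [simp]:
  "dim_row (mat_adjoint A) = dim_col A" "dim_col (mat_adjoint A) = dim_row A"
  by (auto simp: mat_adjoint_def)

lemma index_mat_adjoint [simp]:
  "i < dim_col A \<Longrightarrow> j < dim_row A \<Longrightarrow> mat_adjoint A $$ (i, j) = conjugate (A $$ (j, i))"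
  by (simp add: mat_adjoint_def mat_of_rows_index)

lemma mat_adjoint_carrier [simp]: "A \<in> carrier_mat n m \<Longrightarrow> mat_adjoint A \<in> carrier_mat m n"
  by auto

lemma mat_adjoint_adjoint [simp]: "mat_adjoint (mat_adjoint A) = (A :: complex mat)"
  by (intro eq_matI) auto

lemma mat_adjoint_one [simp]: "mat_adjoint (1\<^sub>m n :: complex mat) = 1\<^sub>m n"
  by (intro eq_matI) auto

lemma mat_adjoint_diag: "mat_adjoint (mat_diag n f :: complex mat) = mat_diag n (\<lambda>i. cnj (f i))"
  by (intro eq_matI) (auto simp: mat_diag_def)

lemma mat_adjoint_cscalar_prod:
  fixes A :: "complex mat"
  assumes "A \<in> carrier_mat n m" "v \<in> carrier_vec m" "w \<in> carrier_vec n"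
  shows "(A *\<^sub>v v) \<bullet>c w = v \<bullet>c (mat_adjoint A *\<^sub>v w)"
proof -
  have "(A *\<^sub>v v) \<bullet>c w = (\<Sum>i<n. \<Sum>k<m. A $$ (i, k) * v $ k * cnj (w $ i))"
    using assms by (auto simp: scalar_prod_def atLeast0LessThan sum_distrib_right intro!: sum.cong)
  also have "\<dots> = (\<Sum>k<m. \<Sum>i<n. A $$ (i, k) * v $ k * cnj (w $ i))"
    by (rule sum.swap)
  also have "\<dots> = v \<bullet>c (mat_adjoint A *\<^sub>v w)"
    using assms
    by (auto simp: scalar_prod_def atLeast0LessThan sum_distrib_left algebra_simps intro!: sum.cong)
  finally show ?thesis .
qed

lemma unitary_mat_adjoint: "unitary_mat n U \<Longrightarrow> unitary_mat n (mat_adjoint U)"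
  by (auto simp: unitary_mat_def)

lemma unitary_mat_one [simp]: "unitary_mat n (1\<^sub>m n)"
  by (simp add: unitary_mat_def)

lemma sqnorm_unitary:
  assumes "unitary_mat n U" "v \<in> carrier_vec n"
  shows "sqnorm (U *\<^sub>v v) = sqnorm v"
proof -
  have U: "U \<in> carrier_mat n n" "mat_adjoint U * U = 1\<^sub>m n"
    using assms by (auto simp: unitary_mat_def)
  have "(U *\<^sub>v v) \<bullet>c (U *\<^sub>v v) = v \<bullet>c (mat_adjoint U *\<^sub>v (U *\<^sub>v v))"
    using U assms(2) by (intro mat_adjoint_cscalar_prod) auto
  also have "mat_adjoint U *\<^sub>v (U *\<^sub>v v) = v"
    using U assms(2) by (metis assoc_mult_mat_vec mat_adjoint_carrier one_mult_mat_vec)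
  finally show ?thesis
    by (simp add: sqnorm_def)
qed

lemma index_mat_diag_mult_vec:
  assumes "v \<in> carrier_vec n" "i < n"
  shows "(mat_diag n f *\<^sub>v v) $ i = (f i * v $ i :: complex)"
  using assms
  by (simp add: mat_diag_def scalar_prod_def atLeast0LessThan if_distrib[of "\<lambda>x. x * _"] cong: if_cong)

section \<open>Queries act slice by slice\<close>

definition slice :: "nat \<Rightarrow> nat \<Rightarrow> nat \<Rightarrow> complex vec \<Rightarrow> complex vec" where
  "slice N d w v = vec N (\<lambda>x. v $ (x * d + w))"

lemma slice_carrier [simp]: "slice N d w v \<in> carrier_vec N"
  by (simp add: slice_def)

lemma pair_index_less:
  assumes "x < N" "w < d"
  shows "x * d + w < N * (d::nat)"
proof -
  have "x * d + w < (x + 1) * d"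
    using assms by simp
  also have "\<dots> \<le> N * d"
    using assms by (intro mult_right_mono) auto
  finally show ?thesis .
qed

lemma sum_pair_index:
  fixes f :: "nat \<Rightarrow> 'a::comm_monoid_add"
  shows "(\<Sum>i<N * d. f i) = (\<Sum>x<N. \<Sum>w<d. f (x * d + w))"
proof -
  have "(\<Sum>w<d. f (x * d + w)) = sum f {x * d..<x * d + d}" for x
    using sum.shift_bounds_nat_ivl[of f 0 "x * d" d]
    by (simp add: atLeast0LessThan add.commute)
  then show ?thesis
    by (simp add: sum.nat_group)
qed

lemma slice_minus:
  assumes "v \<in> carrier_vec (N * d)" "u \<in> carrier_vec (N * d)" "w < d"
  shows "slice N d w (v - u) = slice N d w v - slice N d w u"
  using assms by (intro eq_vecI) (auto simp: slice_def pair_index_less)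

lemma slice_add:
  assumes "v \<in> carrier_vec (N * d)" "u \<in> carrier_vec (N * d)" "w < d"
  shows "slice N d w (v + u) = slice N d w v + slice N d w u"
  using assms by (intro eq_vecI) (auto simp: slice_def pair_index_less)

lemma sqnorm_slices:
  assumes "v \<in> carrier_vec (N * d)"
  shows "sqnorm v = (\<Sum>w<d. sqnorm (slice N d w v))"
proof -
  have "sqnorm v = (\<Sum>x<N. \<Sum>w<d. (cmod (v $ (x * d + w)))\<^sup>2)"
    using assms by (simp add: sqnorm_sum sum_pair_index)
  also have "\<dots> = (\<Sum>w<d. \<Sum>x<N. (cmod (v $ (x * d + w)))\<^sup>2)"
    by (rule sum.swap)
  finally show ?thesis
    by (simp add: sqnorm_sum slice_def)
qed

lemma vec_eq_if_slices_eq: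
  assumes "v \<in> carrier_vec (N * d)" "u \<in> carrier_vec (N * d)"
    and "\<And>w. w < d \<Longrightarrow> slice N d w v = slice N d w u"
  shows "v = u"
proof (rule eq_vecI)
  fix i assume "i < dim_vec u"
  then have i: "i < N * d" using assms(2) by simp
  then have "d > 0" by (cases d) auto
  then have "i mod d < d" "i div d < N"
    using i by (auto simp: less_mult_imp_div_less)
  then have "slice N d (i mod d) v $ (i div d) = slice N d (i mod d) u $ (i div d)"
    using assms(3) by simp
  then show "v $ i = u $ i"
    using \<open>i div d < N\<close> by (simp add: slice_def)
qed (use assms in auto)

section \<open>Tensor products with a diagonal factor, and controlled queries\<close>

lemma kron_carrier [simp]:
  "A \<in> carrier_mat a b \<Longrightarrow> B \<in> carrier_mat c d \<Longrightarrow> kron A B \<in> carrier_mat (a * c) (b * d)"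
  by (auto simp: kron_def)

lemma slice_kron_diag:
  assumes X: "X \<in> carrier_mat N N" and v: "v \<in> carrier_vec (N * d)" and w: "w < d"
  shows "slice N d w (kron X (mat_diag d f) *\<^sub>v v) = f w \<cdot>\<^sub>v (X *\<^sub>v slice N d w v)"
proof (rule eq_vecI)
  fix x assume "x < dim_vec (f w \<cdot>\<^sub>v (X *\<^sub>v slice N d w v))"
  then have x: "x < N" using X by simp
  have xw: "x * d + w < N * d" by (rule pair_index_less[OF x w])
  have div_mod: "(y * d + u) div d = y" "(y * d + u) mod d = u" if "u < d" for y u
    using that by auto
  have K: "kron X (mat_diag d f) \<in> carrier_mat (N * d) (N * d)"
    using X by simp
  have "slice N d w (kron X (mat_diag d f) *\<^sub>v v) $ x =
      (\<Sum>k<N * d. kron X (mat_diag d f) $$ (x * d + w, k) * v $ k)"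
    using x xw K v by (auto simp: slice_def scalar_prod_def atLeast0LessThan)
  also have "\<dots> = (\<Sum>y<N. \<Sum>u<d. kron X (mat_diag d f) $$ (x * d + w, y * d + u) * v $ (y * d + u))"
    by (rule sum_pair_index)
  also have "\<dots> = (\<Sum>y<N. \<Sum>u<d. if u = w then X $$ (x, y) * f w * v $ (y * d + w) else 0)"
    using X w xw by (intro sum.cong refl) (auto simp: kron_def mat_diag_def pair_index_less div_mod)
  also have "\<dots> = (\<Sum>y<N. X $$ (x, y) * f w * v $ (y * d + w))"
    using w by simp
  also have "\<dots> = (f w \<cdot>\<^sub>v (X *\<^sub>v slice N d w v)) $ x"
    using X x
    by (auto simp: slice_def scalar_prod_def atLeast0LessThan sum_distrib_left algebra_simps
        intro!: sum.cong)
  finally show "slice N d w (kron X (mat_diag d f) *\<^sub>v v) $ x = (f w \<cdot>\<^sub>v (X *\<^sub>v slice N d w v)) $ x" .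
qed (use X in \<open>auto simp: slice_def\<close>)

definition ctl_active :: "nat option \<Rightarrow> nat \<Rightarrow> bool" where
  "ctl_active ctl w = (case ctl of None \<Rightarrow> True | Some b \<Rightarrow> odd (w div b))"

lemma on_register_carrier [simp]:
  "X \<in> carrier_mat N N \<Longrightarrow> on_register N d ctl X \<in> carrier_mat (N * d) (N * d)"
  by (auto simp: on_register_def split: option.splits)

lemma slice_on_register:
  assumes X: "X \<in> carrier_mat N N" and v: "v \<in> carrier_vec (N * d)" and w: "w < d"
  shows "slice N d w (on_register N d ctl X *\<^sub>v v) =
    (if ctl_active ctl w then X *\<^sub>v slice N d w v else slice N d w v)"
proof (cases ctl)
  case None
  then show ?thesis
    using slice_kron_diag[OF assms, of "\<lambda>_. 1"] by (simp add: on_register_def ctl_active_def)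
next
  case (Some b)
  \<comment> \<open>The parts with the control on and off. On each slice exactly one of them has
    factor 1 and the other vanishes.\<close>
  let ?P = "kron X (mat_diag d (\<lambda>w. if odd (w div b) then 1 else 0))"
  let ?Q = "kron (1\<^sub>m N) (mat_diag d (\<lambda>w. if odd (w div b) then 0 else 1))"
  have c: "?P \<in> carrier_mat (N * d) (N * d)" "?Q \<in> carrier_mat (N * d) (N * d)"
    using X by auto
  have "slice N d w (on_register N d ctl X *\<^sub>v v) = slice N d w (?P *\<^sub>v v) + slice N d w (?Q *\<^sub>v v)"
    by (simp add: Some on_register_def add_mult_distrib_mat_vec[OF c v]
        slice_add[OF mult_mat_vec_carrier[OF c(1) v] mult_mat_vec_carrier[OF c(2) v] w])
  also have "\<dots> = (if odd (w div b) then 1 else 0) \<cdot>\<^sub>v (X *\<^sub>v slice N d w v) +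
      (if odd (w div b) then 0 else 1) \<cdot>\<^sub>v slice N d w v"
    using slice_kron_diag[OF X v w] slice_kron_diag[OF one_carrier_mat v w] by simp
  also have "\<dots> = (if odd (w div b) then X *\<^sub>v slice N d w v else slice N d w v)"
    using X by (intro eq_vecI) (auto simp: slice_def)
  finally show ?thesis
    by (simp add: Some ctl_active_def)
qed

text \<open>In the trivial instance every query, controlled or inverted, leaves the state
  alone.\<close>

lemma on_register_one:
  assumes "v \<in> carrier_vec (N * d)"
  shows "on_register N d ctl (1\<^sub>m N) *\<^sub>v v = v"
proof (rule vec_eq_if_slices_eq[where N = N and d = d])
  show "on_register N d ctl (1\<^sub>m N) *\<^sub>v v \<in> carrier_vec (N * d)"
    by (meson assms mult_mat_vec_carrier on_register_carrier one_carrier_mat)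
qed (use assms in \<open>auto simp: slice_on_register\<close>)

lemma sqnorm_on_register:
  assumes X: "unitary_mat N X" and v: "v \<in> carrier_vec (N * d)"
  shows "sqnorm (on_register N d ctl X *\<^sub>v v) = sqnorm v"
proof -
  have c: "X \<in> carrier_mat N N" using X by (simp add: unitary_mat_def)
  then have "on_register N d ctl X *\<^sub>v v \<in> carrier_vec (N * d)"
    by (meson v mult_mat_vec_carrier on_register_carrier)
  then show ?thesis
    using X c v by (simp add: sqnorm_slices[where d = d and N = N] slice_on_register sqnorm_unitary if_distrib cong: if_cong)
qed

text \<open>Transfers a bound for the bare black box to the whole space, whatever the control.
  \<open>F\<close> is the squared amplitude at \<open>j\<close> for input queries and the squared
  norm for advice queries, each up to a constant factor.\<close>

lemma sqnorm_on_register_minus_le: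
  assumes X: "X \<in> carrier_mat N N" and v: "v \<in> carrier_vec (N * d)"
    and bnd: "\<And>u. u \<in> carrier_vec N \<Longrightarrow> sqnorm (X *\<^sub>v u - u) \<le> F u"
    and nonneg: "\<And>u. 0 \<le> F u"
  shows "sqnorm (on_register N d ctl X *\<^sub>v v - v) \<le> (\<Sum>w<d. F (slice N d w v))"
proof -
  have c: "on_register N d ctl X *\<^sub>v v \<in> carrier_vec (N * d)"
    by (meson X v mult_mat_vec_carrier on_register_carrier)
  have "sqnorm (on_register N d ctl X *\<^sub>v v - v) =
      (\<Sum>w<d. sqnorm (slice N d w (on_register N d ctl X *\<^sub>v v - v)))"
    using c v by (intro sqnorm_slices) auto
  also have "\<dots> \<le> (\<Sum>w<d. F (slice N d w v))"
  proof (rule sum_mono)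
    fix w assume "w \<in> {..<d}"
    then have w: "w < d" by simp
    \<comment> \<open>For slices whose control is off: they do not move, so \<open>nonneg\<close>
      suffices there.\<close>
    have "slice N d w v - slice N d w v = 0\<^sub>v N"
      by (intro eq_vecI) (auto simp: slice_def)
    then have "sqnorm (slice N d w v - slice N d w v) = 0"
      by (simp add: sqnorm_sum)
    then show "sqnorm (slice N d w (on_register N d ctl X *\<^sub>v v - v)) \<le> F (slice N d w v)"
      using bnd[of "slice N d w v"] nonneg[of "slice N d w v"] c v w X
      by (auto simp: slice_minus slice_on_register)
  qed
  finally show ?thesis .
qed

section \<open>The hybrid argument\<close>

text \<open>Cauchy--Schwarz against the constant 1. This is the source of the square root in the
  lower bound.\<close>

lemma sum_sqrt_le:
  fixes f :: "'a \<Rightarrow> real"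
  assumes "finite J" "\<And>j. j \<in> J \<Longrightarrow> 0 \<le> f j" "(\<Sum>j\<in>J. f j) \<le> 1"
  shows "(\<Sum>j\<in>J. sqrt (f j)) \<le> sqrt (card J)"
proof -
  have "(\<Sum>j\<in>J. sqrt (f j)) = (\<Sum>j\<in>J. \<bar>sqrt (f j)\<bar> * \<bar>1\<bar>)"
    using assms by (intro sum.cong) auto
  also have "\<dots> \<le> L2_set (\<lambda>j. sqrt (f j)) J * L2_set (\<lambda>_. 1) J"
    by (rule L2_set_mult_ineq)
  also have "L2_set (\<lambda>j. sqrt (f j)) J = sqrt (\<Sum>j\<in>J. f j)"
    using assms unfolding L2_set_def by (intro arg_cong[where f = sqrt] sum.cong) auto
  also have "sqrt (\<Sum>j\<in>J. f j) * L2_set (\<lambda>_. 1) J \<le> 1 * sqrt (card J)"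
    using assms by (intro mult_mono) (auto simp: L2_set_constant)
  finally show ?thesis by simp
qed

text \<open>Isolates what the hybrid argument needs of the hard instances. An input query moves a
  vector only in proportion to its amplitude at \<open>j\<close>, an advice query in proportion to
  its whole norm. The adjoints are included because inverse queries are allowed.\<close>

locale oracle_family =
  fixes N d :: nat and J :: "nat set" and U A :: "nat \<Rightarrow> complex mat" and a b :: real
  assumes J: "J \<subseteq> {..<N}" and a: "0 \<le> a" and b: "0 \<le> b"
    and U_unitary: "j \<in> J \<Longrightarrow> unitary_mat N (U j)"
    and A_unitary: "j \<in> J \<Longrightarrow> unitary_mat N (A j)"
    and U_close: "j \<in> J \<Longrightarrow> X \<in> {U j, mat_adjoint (U j)} \<Longrightarrow> u \<in> carrier_vec N \<Longrightarrow>
      sqnorm (X *\<^sub>v u - u) \<le> a\<^sup>2 * (cmod (u $ j))\<^sup>2"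
    and A_close: "j \<in> J \<Longrightarrow> X \<in> {A j, mat_adjoint (A j)} \<Longrightarrow> u \<in> carrier_vec N \<Longrightarrow>
      sqnorm (X *\<^sub>v u - u) \<le> b\<^sup>2 * sqnorm u"
begin

lemma finite_J: "finite J"
  using J finite_subset by blast

abbreviation run :: "nat \<Rightarrow> gate list \<Rightarrow> complex vec \<Rightarrow> complex vec" where
  "run j gs v \<equiv> fold (\<lambda>g \<psi>. gate_mat N d (U j) (A j) g *\<^sub>v \<psi>) gs v"

abbreviation idle_run :: "gate list \<Rightarrow> complex vec \<Rightarrow> complex vec" where
  "idle_run gs v \<equiv> fold (\<lambda>g \<psi>. gate_mat N d (1\<^sub>m N) (1\<^sub>m N) g *\<^sub>v \<psi>) gs v"

lemma gate_mat_carrier: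
  assumes "j \<in> J" "valid_gate N d g"
  shows "gate_mat N d (U j) (A j) g \<in> carrier_mat (N * d) (N * d)"
  using assms U_unitary[of j] A_unitary[of j]
  by (cases g)
    (auto simp: gate_mat_def valid_gate_def unitary_mat_def Let_def
      intro!: on_register_carrier split: blackbox.splits)

lemma vnorm_gate_mat:
  assumes "j \<in> J" "valid_gate N d g" "v \<in> carrier_vec (N * d)"
  shows "vnorm (gate_mat N d (U j) (A j) g *\<^sub>v v) = vnorm v"
  using assms U_unitary[of j] A_unitary[of j]
  by (cases g)
    (auto simp: gate_mat_def valid_gate_def vnorm_def Let_def sqnorm_unitary
      intro!: sqnorm_on_register unitary_mat_adjoint split: blackbox.splits)

lemma idle_gate:
  assumes "valid_gate N d g" "v \<in> carrier_vec (N * d)"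
  shows "gate_mat N d (1\<^sub>m N) (1\<^sub>m N) g *\<^sub>v v \<in> carrier_vec (N * d)"
    and "sqnorm (gate_mat N d (1\<^sub>m N) (1\<^sub>m N) g *\<^sub>v v) = sqnorm v"
  using assms
  by (cases g; auto simp: gate_mat_def valid_gate_def Let_def sqnorm_unitary on_register_one
      unitary_mat_def split: blackbox.splits)+

text \<open>The error that one gate creates on a common state \<open>v\<close>, summed over all
  instances. Since \<open>v\<close> does not depend on \<open>j\<close>, its weights on the register
  values add up to at most 1, and an input query costs \<open>sqrt (card J)\<close> in place of
  \<open>card J\<close>. Advice queries get no such saving: each instance pays
  \<open>b\<close>.\<close>

lemma sum_gate_diff:
  assumes g: "valid_gate N d g" and v: "v \<in> carrier_vec (N * d)" and le1: "sqnorm v \<le> 1"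
  shows "(\<Sum>j\<in>J. vnorm (gate_mat N d (U j) (A j) g *\<^sub>v v - gate_mat N d (1\<^sub>m N) (1\<^sub>m N) g *\<^sub>v v))
    \<le> (case g of Fixed V \<Rightarrow> 0 | Query Input _ _ \<Rightarrow> a * sqrt (card J)
        | Query Advice _ _ \<Rightarrow> b * card J)"
proof (cases g)
  case (Fixed V)
  then have "gate_mat N d X Y g *\<^sub>v v - gate_mat N d Z W g *\<^sub>v v = 0\<^sub>v (N * d)" for X Y Z W
    using g v by (auto simp: gate_mat_def valid_gate_def unitary_mat_def)
  then show ?thesis
    using Fixed by (simp add: vnorm_def sqnorm_sum)
next
  case (Query q adj ctl)
  have idle: "gate_mat N d (1\<^sub>m N) (1\<^sub>m N) g *\<^sub>v v = v"
    using v by (cases q) (auto simp: Query gate_mat_def on_register_one Let_def)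
  define X where "X j = (let Y = (case q of Input \<Rightarrow> U j | Advice \<Rightarrow> A j)
     in if adj then mat_adjoint Y else Y)" for j
  have gm: "gate_mat N d (U j) (A j) g = on_register N d ctl (X j)" for j
    by (simp add: Query gate_mat_def X_def Let_def)
  have X: "X j \<in> carrier_mat N N" if "j \<in> J" for j
    using U_unitary[OF that] A_unitary[OF that]
    by (auto simp: X_def unitary_mat_def Let_def split: blackbox.splits)
  show ?thesis
  proof (cases q)
    case Input
    define p where "p j = (\<Sum>w<d. (cmod (slice N d w v $ j))\<^sup>2)" for j
    have "vnorm (on_register N d ctl (X j) *\<^sub>v v - v) \<le> a * sqrt (p j)" if j: "j \<in> J" for j
    proof -
      have "sqnorm (on_register N d ctl (X j) *\<^sub>v v - v) \<le>
          (\<Sum>w<d. a\<^sup>2 * (cmod (slice N d w v $ j))\<^sup>2)"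
        using j by (intro sqnorm_on_register_minus_le X v U_close) (auto simp: X_def Input Let_def)
      also have "\<dots> = a\<^sup>2 * p j"
        by (simp add: p_def sum_distrib_left)
      finally have "vnorm (on_register N d ctl (X j) *\<^sub>v v - v) \<le> sqrt (a\<^sup>2 * p j)"
        by (simp add: vnorm_def)
      then show ?thesis
        using a by (simp add: real_sqrt_mult)
    qed
    then have "(\<Sum>j\<in>J. vnorm (on_register N d ctl (X j) *\<^sub>v v - v)) \<le> a * (\<Sum>j\<in>J. sqrt (p j))"
      by (auto simp: sum_distrib_left intro: sum_mono)
    also have "(\<Sum>j\<in>J. sqrt (p j)) \<le> sqrt (card J)"
    proof (rule sum_sqrt_le[OF finite_J])
      have "(\<Sum>j\<in>J. p j) \<le> (\<Sum>j<N. p j)"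
        using J by (intro sum_mono2) (auto simp: p_def sum_nonneg)
      also have "\<dots> = (\<Sum>w<d. sqnorm (slice N d w v))"
        unfolding p_def sqnorm_sum by (subst sum.swap) (simp add: slice_def)
      also have "\<dots> \<le> 1"
        using le1 sqnorm_slices[OF v] by simp
      finally show "(\<Sum>j\<in>J. p j) \<le> 1" .
    qed (auto simp: p_def sum_nonneg)
    finally show ?thesis
      using a unfolding idle gm by (simp add: Query Input mult_left_mono)
  next
    case Advice
    have "vnorm (on_register N d ctl (X j) *\<^sub>v v - v) \<le> b" if j: "j \<in> J" for j
    proof -
      have "sqnorm (on_register N d ctl (X j) *\<^sub>v v - v) \<le>
          (\<Sum>w<d. b\<^sup>2 * sqnorm (slice N d w v))"
        using j by (intro sqnorm_on_register_minus_le X v A_close) (auto simp: X_def Advice Let_def)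
      also have "\<dots> = b\<^sup>2 * sqnorm v"
        by (simp add: sqnorm_slices[OF v] sum_distrib_left)
      also have "\<dots> \<le> b\<^sup>2"
        using le1 by (simp add: mult_left_le)
      finally show ?thesis
        using b unfolding vnorm_def by (metis real_le_lsqrt sqnorm_nonneg)
    qed
    then have "(\<Sum>j\<in>J. vnorm (on_register N d ctl (X j) *\<^sub>v v - v)) \<le> (\<Sum>j\<in>J. b)"
      by (rule sum_mono)
    then show ?thesis
      unfolding idle gm by (simp add: Query Advice mult.commute)
  qed
qed

section \<open>Complete runs of the algorithm\<close>

lemma run_carrier:
  assumes "j \<in> J" "\<forall>g \<in> set gs. valid_gate N d g" "v \<in> carrier_vec (N * d)"
  shows "run j gs v \<in> carrier_vec (N * d)"
  using assms
proof (induction gs arbitrary: v)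
  case (Cons g gs)
  then show ?case
    by (simp add: mult_mat_vec_carrier[OF gate_mat_carrier])
qed simp

lemma run_sqnorm:
  assumes "j \<in> J" "\<forall>g \<in> set gs. valid_gate N d g" "v \<in> carrier_vec (N * d)"
  shows "sqnorm (run j gs v) = sqnorm v"
  using assms
proof (induction gs arbitrary: v)
  case (Cons g gs)
  then show ?case
    by (simp add: mult_mat_vec_carrier[OF gate_mat_carrier] vnorm_gate_mat flip: vnorm_power2)
qed simp

lemma idle_run:
  assumes "\<forall>g \<in> set gs. valid_gate N d g" "v \<in> carrier_vec (N * d)"
  shows "idle_run gs v \<in> carrier_vec (N * d)" "sqnorm (idle_run gs v) = sqnorm v"
  using assms by (induction gs arbitrary: v) (auto simp: idle_gate)

abbreviation queries :: "blackbox \<Rightarrow> gate list \<Rightarrow> nat" where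
  "queries q gs \<equiv> length (filter (\<lambda>g. \<exists>adj ctl. g = Query q adj ctl) gs)"

text \<open>Old distances are preserved because the gates are unitary, and each new error is
  measured on the state of the idle run, which is the same for all \<open>j\<close>. The start
  states \<open>vs j\<close> and \<open>v\<close> are kept arbitrary so that the induction can pass
  to the states after the first gate.\<close>

lemma hybrid:
  assumes "\<forall>g \<in> set gs. valid_gate N d g" "v \<in> carrier_vec (N * d)" "sqnorm v \<le> 1"
    "\<And>j. j \<in> J \<Longrightarrow> vs j \<in> carrier_vec (N * d)"
  shows "(\<Sum>j\<in>J. vnorm (run j gs (vs j) - idle_run gs v)) \<le>
    (\<Sum>j\<in>J. vnorm (vs j - v)) + a * sqrt (card J) * queries Input gs
      + b * card J * queries Advice gs"
  using assms
proof (induction gs arbitrary: v vs)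
  case (Cons g gs)
  let ?G = "\<lambda>j. gate_mat N d (U j) (A j) g" and ?H = "gate_mat N d (1\<^sub>m N) (1\<^sub>m N) g"
  have g: "valid_gate N d g" using Cons.prems by simp
  have step: "vnorm (?G j *\<^sub>v vs j - ?H *\<^sub>v v) \<le> vnorm (vs j - v) + vnorm (?G j *\<^sub>v v - ?H *\<^sub>v v)"
    if j: "j \<in> J" for j
  proof -
    have c: "?G j \<in> carrier_mat (N * d) (N * d)" by (rule gate_mat_carrier[OF j g])
    \<comment> \<open>The intermediate point applies the true gate to the idle state. It separates
      the inherited distance from the error created by this gate.\<close>
    have "vnorm (?G j *\<^sub>v vs j - ?H *\<^sub>v v) \<le>
        vnorm (?G j *\<^sub>v vs j - ?G j *\<^sub>v v) + vnorm (?G j *\<^sub>v v - ?H *\<^sub>v v)"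
      using Cons.prems(2,4) g j
      by (intro vnorm_minus_triangle[where n = "N * d"] idle_gate mult_mat_vec_carrier[OF c])
    also have "?G j *\<^sub>v vs j - ?G j *\<^sub>v v = ?G j *\<^sub>v (vs j - v)"
      using Cons.prems(2,4) c j by (simp add: mult_minus_distrib_mat_vec)
    also have "vnorm \<dots> = vnorm (vs j - v)"
      using Cons.prems(2,4) g j by (intro vnorm_gate_mat) auto
    finally show ?thesis .
  qed
  have "(\<Sum>j\<in>J. vnorm (run j (g # gs) (vs j) - idle_run (g # gs) v)) \<le>
      (\<Sum>j\<in>J. vnorm (?G j *\<^sub>v vs j - ?H *\<^sub>v v)) + a * sqrt (card J) * queries Input gs
      + b * card J * queries Advice gs"
    using Cons.IH[of "?H *\<^sub>v v" "\<lambda>j. ?G j *\<^sub>v vs j"] Cons.prems g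
    by (simp add: idle_gate mult_mat_vec_carrier[OF gate_mat_carrier])
  also have "(\<Sum>j\<in>J. vnorm (?G j *\<^sub>v vs j - ?H *\<^sub>v v)) \<le>
      (\<Sum>j\<in>J. vnorm (vs j - v)) + (\<Sum>j\<in>J. vnorm (?G j *\<^sub>v v - ?H *\<^sub>v v))"
    unfolding sum.distrib[symmetric] by (intro sum_mono step)
  also have "(\<Sum>j\<in>J. vnorm (?G j *\<^sub>v v - ?H *\<^sub>v v)) \<le>
      (case g of Fixed V \<Rightarrow> 0 | Query Input _ _ \<Rightarrow> a * sqrt (card J)
        | Query Advice _ _ \<Rightarrow> b * card J)"
    using Cons.prems g by (intro sum_gate_diff) auto
  finally show ?case
    by (cases g) (auto simp: algebra_simps split: blackbox.splits)
qed simp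

end

section \<open>Distinguishing two states by a POVM\<close>

definition qform :: "complex mat \<Rightarrow> complex vec \<Rightarrow> real" where
  "qform E v = Re ((E *\<^sub>v v) \<bullet>c v)"

lemma psd_qform_nonneg: "psd_mat n E \<Longrightarrow> v \<in> carrier_vec n \<Longrightarrow> 0 \<le> qform E v"
  by (auto simp: psd_mat_def qform_def less_eq_complex_def)

text \<open>The entrywise form reduces identities between quadratic forms to identities between
  single terms.\<close>

lemma qform_sum:
  assumes "E \<in> carrier_mat n n" "v \<in> carrier_vec n"
  shows "qform E v = (\<Sum>i<n. \<Sum>k<n. Re (E $$ (i, k) * (v $ k * cnj (v $ i))))"
  using assms
  by (auto simp: qform_def scalar_prod_def atLeast0LessThan sum_distrib_right mult.assoc
      simp del: times_complex.sel intro!: sum.cong)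

lemma qform_add_le:
  assumes E: "psd_mat n E" and v: "v \<in> carrier_vec n" and x: "x \<in> carrier_vec n"
  shows "qform E (v + x) \<le> 3 / 2 * qform E v + 3 * qform E x"
proof -
  have c: "E \<in> carrier_mat n n" using E by (simp add: psd_mat_def)
  have y: "v - 2 \<cdot>\<^sub>v x \<in> carrier_vec n" using v x by simp
  \<comment> \<open>Young's inequality: the weights make the cross terms cancel.\<close>
  have young: "Re (f * ((p + q) * cnj (p' + q'))) + 1 / 2 * Re (f * ((p - 2 * q) * cnj (p' - 2 * q')))
      = 3 / 2 * Re (f * (p * cnj p')) + 3 * Re (f * (q * cnj q'))" for f p q p' q' :: complex
    by (simp add: algebra_simps)
  have "qform E (v + x) + 1 / 2 * qform E (v - 2 \<cdot>\<^sub>v x) =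
      (\<Sum>i<n. \<Sum>k<n. Re (E $$ (i, k) * ((v $ k + x $ k) * cnj (v $ i + x $ i)))
        + 1 / 2 * Re (E $$ (i, k) * ((v $ k - 2 * x $ k) * cnj (v $ i - 2 * x $ i))))"
    unfolding qform_sum[OF c add_carrier_vec[OF v x]] qform_sum[OF c y] sum_distrib_left sum.distrib
    using v x by (intro arg_cong2[where f = "(+)"] sum.cong refl) auto
  also have "\<dots> = 3 / 2 * qform E v + 3 * qform E x"
    unfolding young qform_sum[OF c v] qform_sum[OF c x] sum_distrib_left sum.distrib ..
  finally have "qform E (v + x) + 1 / 2 * qform E (v - 2 \<cdot>\<^sub>v x) = 3 / 2 * qform E v + 3 * qform E x" .
  moreover have "0 \<le> qform E (v - 2 \<cdot>\<^sub>v x)"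
    by (rule psd_qform_nonneg[OF E y])
  ultimately show ?thesis by simp
qed

section \<open>Outcome probabilities of a POVM\<close>

definition povm_prob :: "rpovm \<Rightarrow> (real \<Rightarrow> bool) \<Rightarrow> complex vec \<Rightarrow> real" where
  "povm_prob M P v = (\<Sum>(x, E) \<leftarrow> filter (\<lambda>(x, E). P x) M. qform E v)"

lemma povm_prob_simps [simp]:
  "povm_prob [] P v = 0"
  "povm_prob ((x, E) # M) P v = (if P x then qform E v else 0) + povm_prob M P v"
  by (auto simp: povm_prob_def)

lemma povm_prob_disjoint:
  assumes "\<forall>(x, E) \<in> set M. psd_mat n E" "v \<in> carrier_vec n" "\<And>x. \<not> (P x \<and> Q x)"
  shows "povm_prob M P v + povm_prob M Q v \<le> povm_prob M (\<lambda>_. True) v"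
  using assms
proof (induction M)
  case (Cons p M)
  obtain x E where p: "p = (x, E)" by (cases p)
  then have "0 \<le> qform E v"
    using Cons.prems by (intro psd_qform_nonneg[of n]) auto
  then show ?case
    using Cons Cons.prems(3)[of x] by (auto simp: p)
qed simp

text \<open>The bound for a single effect is linear in its quadratic forms, so it can be summed over
  the outcomes without further loss.\<close>

lemma povm_prob_add_le:
  assumes "\<forall>(x, E) \<in> set M. psd_mat n E" "v \<in> carrier_vec n" "u \<in> carrier_vec n"
  shows "povm_prob M P (v + u) \<le> 3 / 2 * povm_prob M P v + 3 * povm_prob M P u"
  using assms
proof (induction M)
  case (Cons p M)
  obtain x E where p: "p = (x, E)" by (cases p)
  then have "qform E (v + u) \<le> 3 / 2 * qform E v + 3 * qform E u"
    using Cons.prems by (intro qform_add_le[of n]) auto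
  then show ?case
    using Cons by (auto simp: p add_divide_distrib)
qed simp

text \<open>Both claims go through one induction, because distributing the product over the sum of
  effects requires the dimensions of the partial sum.\<close>

lemma povm_prob_True:
  assumes "\<forall>(x, E) \<in> set M. psd_mat n E" "v \<in> carrier_vec n"
  shows "povm_prob M (\<lambda>_. True) v = qform (foldr (+) (map snd M) (0\<^sub>m n n)) v"
    and "foldr (+) (map snd M) (0\<^sub>m n n) \<in> carrier_mat n n"
  using assms
proof (induction M)
  case Nil
  {
    case 1
    then show ?case by (simp add: qform_sum[OF zero_carrier_mat])
  next
    case 2
    then show ?case by simp
  }
next
  case (Cons p M)
  {
    case 1
    obtain x E where p: "p = (x, E)" by (cases p)
    have "E \<in> carrier_mat n n" using 1 p by (auto simp: psd_mat_def)
    then show ?case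
      using Cons 1 p
      by (simp add: qform_def add_mult_distrib_mat_vec[where nr = n and nc = n]
          add_scalar_prod_distrib[where n = n])
  next
    case 2
    then show ?case using Cons by (auto simp: psd_mat_def)
  }
qed

lemma povm_prob_total:
  assumes "valid_povm n M" "v \<in> carrier_vec n"
  shows "povm_prob M (\<lambda>_. True) v = sqnorm v"
  using assms povm_prob_True(1)[of M n v] by (simp add: valid_povm_def qform_def sqnorm_def)

text \<open>By disjointness \<open>P\<close> has probability at most 1/3 on \<open>\<phi>\<close>.
  Hence 2/3 is at most \<open>3 / 2 * (1 / 3) + 3 * sqnorm (\<psi> - \<phi>)\<close>, so the squared
  distance is at least 1/18, which exceeds 1/25.\<close>

lemma states_far_apart:
  assumes M: "valid_povm n M" and disj: "\<And>x. \<not> (P x \<and> Q x)"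
    and \<phi>: "\<phi> \<in> carrier_vec n" "sqnorm \<phi> = 1" and \<psi>: "\<psi> \<in> carrier_vec n" "sqnorm \<psi> = 1"
    and P: "2 / 3 \<le> povm_prob M P \<psi>" and Q: "2 / 3 \<le> povm_prob M Q \<phi>"
  shows "1 / 5 \<le> vnorm (\<phi> - \<psi>)"
proof -
  have psd: "\<forall>(x, E) \<in> set M. psd_mat n E" using M by (simp add: valid_povm_def)
  have le: "povm_prob M P v + povm_prob M Q v \<le> sqnorm v" if "v \<in> carrier_vec n" for v
    using povm_prob_disjoint[OF psd that, of P Q] disj povm_prob_total[OF M that] by simp
  have x: "\<psi> - \<phi> \<in> carrier_vec n" using \<phi> \<psi> by simp
  \<comment> \<open>The difference is not normalised, but \<open>le\<close> holds for every vector.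
    Dropping the nonnegative \<open>Q\<close> part bounds the \<open>P\<close> part by the squared
    norm.\<close>
  have "0 \<le> qform E (\<psi> - \<phi>)" if "(y, E) \<in> set M" for y E
    using psd that by (intro psd_qform_nonneg[OF _ x]) auto
  then have "0 \<le> povm_prob M Q (\<psi> - \<phi>)"
    by (auto simp: povm_prob_def intro!: sum_list_nonneg)
  then have "povm_prob M P (\<psi> - \<phi>) \<le> sqnorm (\<psi> - \<phi>)"
    using le[OF x] by simp
  moreover have "povm_prob M P \<phi> \<le> 1 / 3"
    using le[OF \<phi>(1)] Q \<phi> by simp
  moreover have "\<phi> + (\<psi> - \<phi>) = \<psi>"
    using \<phi> \<psi> by (intro eq_vecI) auto
  moreover have "povm_prob M P (\<phi> + (\<psi> - \<phi>)) \<le> 3 / 2 * povm_prob M P \<phi> + 3 * povm_prob M P (\<psi> - \<phi>)"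
    by (rule povm_prob_add_le[OF psd \<phi>(1) x])
  ultimately have "(1 / 5)\<^sup>2 \<le> sqnorm (\<psi> - \<phi>)"
    using P by (simp add: power2_eq_square)
  also have "sqnorm (\<psi> - \<phi>) = sqnorm (\<phi> - \<psi>)"
    using \<phi> \<psi> by (auto simp: sqnorm_sum norm_minus_commute intro!: sum.cong)
  finally show ?thesis
    unfolding vnorm_def by (rule real_le_rsqrt)
qed

section \<open>The hard instances\<close>

text \<open>The plane rotation with cosine \<open>c\<close> and sine \<open>s\<close>, sending
  \<open>|0>\<close> to \<open>c |0> + s |j>\<close>. As a sum of three terms, each supported on one
  column per row, it turns matrix-vector products into three one-point sums.\<close>

definition rotation :: "nat \<Rightarrow> nat \<Rightarrow> real \<Rightarrow> real \<Rightarrow> complex mat" where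
  "rotation N j c s = mat N N (\<lambda>(x, y).
     (if y = x then (if x = 0 \<or> x = j then of_real c else 1) else 0)
     + (if y = 0 then (if x = j then of_real s else 0) else 0)
     + (if y = j then (if x = 0 then - of_real s else 0) else 0))"

lemma rotation_carrier [simp]: "rotation N j c s \<in> carrier_mat N N"
  by (simp add: rotation_def)

lemma rotation_mult_vec:
  assumes "0 < j" "j < N" "u \<in> carrier_vec N" "x < N"
  shows "(rotation N j c s *\<^sub>v u) $ x =
    (if x = 0 then of_real c * u $ 0 - of_real s * u $ j
     else if x = j then of_real s * u $ 0 + of_real c * u $ j else u $ x)"
proof -
  have "(rotation N j c s *\<^sub>v u) $ x = (\<Sum>y<N. rotation N j c s $$ (x, y) * u $ y)"
    using assms carrier_matD[OF rotation_carrier] by (simp add: scalar_prod_def atLeast0LessThan)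
  also have "\<dots> = (\<Sum>y<N.
     (if y = x then (if x = 0 \<or> x = j then of_real c else 1) * u $ x else 0)
     + (if y = 0 then (if x = j then of_real s else 0) * u $ 0 else 0)
     + (if y = j then (if x = 0 then - of_real s else 0) * u $ j else 0))"
    using assms by (intro sum.cong refl) (auto simp: rotation_def)
  finally show ?thesis
    using assms by (auto simp: sum.distrib)
qed

lemma mat_adjoint_rotation:
  assumes "0 < j" "j < N"
  shows "mat_adjoint (rotation N j c s) = rotation N j c (- s)"
  using assms by (intro eq_matI) (auto simp: rotation_def)

lemma rotation_inverse:
  assumes j: "0 < j" "j < N" and cs: "c\<^sup>2 + s\<^sup>2 = 1"
  shows "rotation N j c s * rotation N j c (- s) = 1\<^sub>m N"
proof (rule eq_matI)
  fix x y assume "x < dim_row (1\<^sub>m N :: complex mat)" "y < dim_col (1\<^sub>m N :: complex mat)"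
  then have xy: "x < N" "y < N" by auto
  have cs': "complex_of_real c * complex_of_real c + complex_of_real s * complex_of_real s = 1"
    using cs by (metis of_real_1 of_real_add of_real_mult power2_eq_square)
  have "(rotation N j c s * rotation N j c (- s)) $$ (x, y) =
      (rotation N j c s *\<^sub>v col (rotation N j c (- s)) y) $ x"
    using xy by (simp add: rotation_def)
  also have "\<dots> = (1\<^sub>m N) $$ (x, y)"
    using xy j cs'
    by (subst rotation_mult_vec[OF j]) (auto simp: rotation_def algebra_simps)
  finally show "(rotation N j c s * rotation N j c (- s)) $$ (x, y) = (1\<^sub>m N) $$ (x, y)" .
qed (auto simp: rotation_def)

lemma unitary_rotation:
  assumes "0 < j" "j < N" "c\<^sup>2 + s\<^sup>2 = 1"
  shows "unitary_mat N (rotation N j c s)"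
  using rotation_inverse[of j N c s] rotation_inverse[of j N c "- s"] assms
  by (simp add: unitary_mat_def mat_adjoint_rotation)

text \<open>On the plane of coordinates 0 and \<open>j\<close> the difference is a multiple of an
  isometry, with squared factor \<open>2 - 2 * c\<close>. Since \<open>0 \<le> c \<le> 1\<close>,
  also \<open>1 - c \<le> 1 - c * c = s * s\<close>, which leaves ample room below the squared
  factor \<open>4 * s * s\<close>.\<close>

lemma sqnorm_rotation_minus_le:
  assumes j: "0 < j" "j < N" and cs: "c\<^sup>2 + s\<^sup>2 = 1" and c: "0 \<le> c" and u: "u \<in> carrier_vec N"
  shows "sqnorm (rotation N j c s *\<^sub>v u - u) \<le> (2 * s)\<^sup>2 * sqnorm u"
proof -
  let ?w = "rotation N j c s *\<^sub>v u - u"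
  have dim: "dim_vec ?w = N" using u by simp
  have w: "?w $ 0 = of_real (c - 1) * u $ 0 - of_real s * u $ j"
    "?w $ j = of_real s * u $ 0 + of_real (c - 1) * u $ j"
    using j u by (simp_all add: rotation_mult_vec del: index_mult_mat_vec) (simp_all add: algebra_simps)
  have "sqnorm ?w = (\<Sum>i\<in>{0, j}. (cmod (?w $ i))\<^sup>2)"
    unfolding sqnorm_sum dim
    using j u by (intro sum.mono_neutral_right) (auto simp: rotation_mult_vec simp del: index_mult_mat_vec)
  also have "\<dots> = (cmod (?w $ 0))\<^sup>2 + (cmod (?w $ j))\<^sup>2"
    using j by simp
  also have "\<dots> = ((c - 1)\<^sup>2 + s\<^sup>2) * ((cmod (u $ 0))\<^sup>2 + (cmod (u $ j))\<^sup>2)"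
    unfolding w by (simp add: cmod_power2) (simp add: power2_eq_square algebra_simps)
  also have "\<dots> \<le> (2 * s)\<^sup>2 * sqnorm u"
  proof (rule mult_mono)
    have "c \<le> 1"
      using cs c by (metis le_add_same_cancel1 power2_le_imp_le zero_le_one one_power2 zero_le_power2)
    then have "c\<^sup>2 \<le> c"
      using c by (simp add: power2_eq_square mult_left_le)
    then show "(c - 1)\<^sup>2 + s\<^sup>2 \<le> (2 * s)\<^sup>2"
      using cs \<open>c \<le> 1\<close> by (simp add: power2_eq_square algebra_simps)
    have "(cmod (u $ 0))\<^sup>2 + (cmod (u $ j))\<^sup>2 = (\<Sum>i\<in>{0, j}. (cmod (u $ i))\<^sup>2)"
      using j by simp
    also have "\<dots> \<le> sqnorm u"
      unfolding sqnorm_sum using j u by (intro sum_mono2) auto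
    finally show "(cmod (u $ 0))\<^sup>2 + (cmod (u $ j))\<^sup>2 \<le> sqnorm u" .
  qed auto
  finally show ?thesis .
qed

section \<open>Instances with a single nonzero phase\<close>

lemma cmod_cis_minus_one_le: "cmod (cis x - 1) \<le> \<bar>x\<bar>"
proof -
  have "(cmod (cis x - 1))\<^sup>2 = 2 - 2 * cos x"
    by (simp add: cmod_power2 sin_squared_eq power2_diff)
  \<comment> \<open>The chord of the unit circle has length
    \<open>2 * \<bar>sin (x / 2)\<bar>\<close>, at most the arc.\<close>
  also have "\<dots> = (2 * sin (x / 2))\<^sup>2"
    using cos_double_sin[of "x / 2"] by (simp add: power2_eq_square)
  also have "\<dots> \<le> x\<^sup>2"
    unfolding abs_le_square_iff[symmetric] using abs_sin_x_le_abs_x[of "x / 2"] by (simp add: abs_mult)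
  finally show ?thesis
    by (simp add: abs_le_square_iff[symmetric])
qed

text \<open>One family serves three purposes: \<open>3 * \<delta>\<close> gives the hard instances,
  its negative the inverse queries, and 0 the trivial instance.\<close>

definition spike :: "nat \<Rightarrow> real \<Rightarrow> nat \<Rightarrow> real" where
  "spike j \<phi> i = (if i = j then \<phi> else 0)"

lemma spectral_mat_one: "spectral_mat N (1\<^sub>m N) f = mat_diag N f"
  by (simp add: spectral_mat_def) (metis mat_diag_dim right_mult_one_mat left_mult_one_mat)

lemma max_phase_spike:
  assumes "j < N" "0 \<le> \<phi>"
  shows "max_phase N (spike j \<phi>) = \<phi>"
  unfolding max_phase_def using assms by (intro Max_eqI) (auto simp: spike_def)

lemma unitary_mat_diag_cis: "unitary_mat N (mat_diag N (\<lambda>i. cis (f i)))"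
  by (simp add: unitary_mat_def mat_adjoint_diag cis_cnj cis_mult)

lemma sqnorm_spike_minus_le:
  assumes j: "j < N" and u: "u \<in> carrier_vec N"
  shows "sqnorm (mat_diag N (\<lambda>i. cis (spike j \<phi> i)) *\<^sub>v u - u) \<le> \<phi>\<^sup>2 * (cmod (u $ j))\<^sup>2"
proof -
  let ?w = "mat_diag N (\<lambda>i. cis (spike j \<phi> i)) *\<^sub>v u - u"
  have dim: "dim_vec ?w = N" using u by simp
  have w: "?w $ i = (if i = j then (cis \<phi> - 1) * u $ j else 0)" if "i < N" for i
    using u that by (simp add: index_mat_diag_mult_vec spike_def algebra_simps del: index_mult_mat_vec)
  have "sqnorm ?w = (\<Sum>i<N. if i = j then (cmod ((cis \<phi> - 1) * u $ j))\<^sup>2 else 0)"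
    unfolding sqnorm_sum dim by (intro sum.cong) (auto simp: w)
  also have "\<dots> = (cmod (cis \<phi> - 1))\<^sup>2 * (cmod (u $ j))\<^sup>2"
    using j by (simp add: norm_mult power_mult_distrib)
  also have "\<dots> \<le> \<phi>\<^sup>2 * (cmod (u $ j))\<^sup>2"
    using cmod_cis_minus_one_le[of \<phi>] by (intro mult_right_mono) (auto simp: abs_le_square_iff[symmetric])
  finally show ?thesis .
qed

text \<open>As \<open>\<phi>\<close> is positive, the maximal eigenspace is spanned by
  \<open>|j>\<close>, where the rotated start state has amplitude \<open>\<gamma>\<close>.\<close>

lemma valid_advice_rotation:
  assumes j: "0 < j" "j < N" and "0 < \<phi>" and cs: "c\<^sup>2 + \<gamma>\<^sup>2 = 1"
  shows "valid_advice N \<gamma> (1\<^sub>m N) (spike j \<phi>) (rotation N j c \<gamma>)"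
proof -
  let ?v = "rotation N j c \<gamma> *\<^sub>v unit_vec N 0"
  let ?w = "max_proj N (1\<^sub>m N) (spike j \<phi>) *\<^sub>v ?v"
  have v: "?v \<in> carrier_vec N" by (rule mult_mat_vec_carrier[OF rotation_carrier]) simp
  have dim: "dim_vec ?w = N" by (simp add: max_proj_def spectral_mat_one mat_diag_def)
  have "?w $ j = of_real \<gamma>"
    using j assms(3) v
    by (simp add: max_proj_def spectral_mat_one index_mat_diag_mult_vec max_phase_spike
        spike_def rotation_mult_vec del: index_mult_mat_vec)
  then have "\<gamma>\<^sup>2 = (cmod (?w $ j))\<^sup>2" by simp
  also have "\<dots> \<le> sqnorm ?w"
    unfolding sqnorm_sum dim using j by (intro member_le_sum) auto
  finally show ?thesis
    using unitary_rotation[OF j cs] by (simp add: valid_advice_def)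
qed

section \<open>Separation of the two sets of correct outputs modulo \<open>2 * pi\<close>\<close>

lemma pi_ge_three: "3 \<le> pi"
  using abs_sin_x_le_abs_x[of "pi / 6"] by (simp add: sin_30)

text \<open>Two representatives of \<open>x\<close> in these intervals would differ by a multiple of
  \<open>2 * pi\<close> that is positive and at most \<open>5 * \<delta>\<close>, hence below
  6.\<close>

lemma approx_disjoint:
  assumes "0 < \<delta>" "\<delta> < 1"
  shows "\<not> (approx_mod_2pi \<delta> 0 x \<and> approx_mod_2pi \<delta> (3 * \<delta>) x)"
proof
  assume "approx_mod_2pi \<delta> 0 x \<and> approx_mod_2pi \<delta> (3 * \<delta>) x"
  then obtain k l :: int where k: "x + 2 * pi * k \<in> {- \<delta>..\<delta>}"
    and l: "x + 2 * pi * l \<in> {2 * \<delta>..4 * \<delta>}"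
    unfolding approx_mod_2pi_def by auto
  have eq: "2 * pi * (real_of_int l - real_of_int k) = (x + 2 * pi * l) - (x + 2 * pi * k)"
    by (simp add: algebra_simps)
  have "0 < 2 * pi * (real_of_int l - real_of_int k)"
    and *: "2 * pi * (real_of_int l - real_of_int k) \<le> 5"
    unfolding eq using k l assms unfolding atLeastAtMost_iff by linarith+
  then have "k < l"
    by (simp add: zero_less_mult_iff)
  then have "2 * pi * 1 \<le> 2 * pi * (real_of_int l - real_of_int k)"
    by (intro mult_left_mono) auto
  then show False
    using * pi_ge_three by linarith
qed

text \<open>With \<open>n = N - 1\<close> instances, the hybrid bound gives \<open>n / 5 \<le> 3 *
  \<delta> * sqrt n * cost alg + 2 * \<gamma> * n * t\<close>. The threshold 1/20 makes the advice
  term at most \<open>n / 10\<close>, half of the left side, so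
  \<open>sqrt n \<le> 30 * \<delta> * cost alg\<close>. Passing from \<open>n\<close> to
  \<open>N\<close> costs another factor 2.\<close>

lemma cost_lower_bound:
  assumes N: "2 \<le> N" and \<gamma>: "0 < \<gamma>" "\<gamma> \<le> 1" and \<delta>: "0 < \<delta>" "\<delta> < 1"
    and t\<gamma>: "real t * \<gamma> \<le> 1 / 20" and alg: "solves_maxQPE_known N \<delta> \<gamma> t alg"
  shows "1 / 60 * sqrt (real N) / \<delta> \<le> real (cost alg)"
proof -
  define d where "d = wdim alg"
  define c where "c = sqrt (1 - \<gamma>\<^sup>2)"
  have cs: "c\<^sup>2 + \<gamma>\<^sup>2 = 1" and c0: "0 \<le> c"
    using \<gamma> by (auto simp: c_def abs_square_le_1)
  \<comment> \<open>Index 0 is left out because the rotation needs a plane spanned by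
    \<open>|0>\<close> and a different \<open>|j>\<close>.\<close>
  define J where "J = {1..<N}"
  define U where "U j = mat_diag N (\<lambda>i. cis (spike j (3 * \<delta>) i))" for j
  define A where "A j = rotation N j c \<gamma>" for j
  have valid: "valid_alg N t alg" and correct: "correct_on N \<delta> \<gamma> alg (1\<^sub>m N)"
    using alg by (auto simp: solves_maxQPE_known_def)
  have gates: "\<forall>g \<in> set (gates alg). valid_gate N d g" and povm: "valid_povm (N * d) (povm alg)"
    and t: "query_count Advice alg \<le> t" and d: "0 < d"
    using valid by (auto simp: valid_alg_def d_def)
  interpret oracle_family N d J U A "3 * \<delta>" "2 * \<gamma>"
  proof
    show "J \<subseteq> {..<N}" by (auto simp: J_def)
    fix j X and u :: "complex vec"
    assume j: "j \<in> J"
    then have j': "0 < j" "j < N" by (auto simp: J_def)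
    show "unitary_mat N (U j)" by (simp add: U_def unitary_mat_diag_cis)
    show "unitary_mat N (A j)" using unitary_rotation[OF j' cs] by (simp add: A_def)
    assume u: "u \<in> carrier_vec N"
    {
      assume "X \<in> {U j, mat_adjoint (U j)}"
      moreover have "mat_adjoint (U j) = mat_diag N (\<lambda>i. cis (spike j (- (3 * \<delta>)) i))"
        by (auto simp: U_def mat_adjoint_diag cis_cnj spike_def intro!: arg_cong[where f = "mat_diag N"])
      ultimately show "sqnorm (X *\<^sub>v u - u) \<le> (3 * \<delta>)\<^sup>2 * (cmod (u $ j))\<^sup>2"
        using sqnorm_spike_minus_le[OF j'(2) u, of "3 * \<delta>"]
          sqnorm_spike_minus_le[OF j'(2) u, of "- (3 * \<delta>)"] by (auto simp: U_def)
    }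
    {
      assume "X \<in> {A j, mat_adjoint (A j)}"
      then show "sqnorm (X *\<^sub>v u - u) \<le> (2 * \<gamma>)\<^sup>2 * sqnorm u"
        using sqnorm_rotation_minus_le[OF j' _ c0 u, of \<gamma>]
          sqnorm_rotation_minus_le[OF j' _ c0 u, of "- \<gamma>"] cs j'
        by (auto simp: A_def mat_adjoint_rotation)
    }
  qed (use \<delta> \<gamma> in auto)
  define e where "e = (unit_vec (N * d) 0 :: complex vec)"
  have e: "e \<in> carrier_vec (N * d)" "sqnorm e = 1"
    using N d by (simp_all add: e_def sqnorm_def)
  define \<phi> where "\<phi> j = run j (gates alg) e" for j
  define \<psi> where "\<psi> = idle_run (gates alg) e"
  have \<psi>: "\<psi> \<in> carrier_vec (N * d)" "sqnorm \<psi> = 1"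
    using idle_run[OF gates e(1)] e by (auto simp: \<psi>_def)
  have prob: "output_prob N alg X Y P = povm_prob (povm alg) P (final_state N alg X Y)" for X Y P
    by (simp add: output_prob_def povm_prob_def qform_def Let_def)
  have "phase_unitary N (1\<^sub>m N) (spike 0 0) = 1\<^sub>m N"
    by (simp add: phase_unitary_def spectral_mat_one spike_def)
  moreover have "2 / 3 \<le> output_prob N alg (phase_unitary N (1\<^sub>m N) (spike 0 0)) (1\<^sub>m N)
      (approx_mod_2pi \<delta> (max_phase N (spike 0 0)))"
  proof (rule correct[unfolded correct_on_def, rule_format])
    have m: "max_phase N (spike 0 0) = 0"
      using N by (intro max_phase_spike) auto
    show "valid_phases N \<delta> (spike 0 0)"
      using \<delta> pi_ge_three by (simp add: valid_phases_def m) (simp add: spike_def)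
    \<comment> \<open>All phases are equal, so every state lies in the maximal eigenspace and the
      identity is valid advice.\<close>
    have "max_proj N (1\<^sub>m N) (spike 0 0) = 1\<^sub>m N"
      by (simp add: max_proj_def spectral_mat_one m) (simp add: spike_def)
    then show "valid_advice N \<gamma> (1\<^sub>m N) (spike 0 0) (1\<^sub>m N)"
      using \<gamma> N by (simp add: valid_advice_def sqnorm_def power_le_one)
  qed
  ultimately have prob0: "2 / 3 \<le> povm_prob (povm alg) (approx_mod_2pi \<delta> 0) \<psi>"
    using N by (simp add: prob final_state_def \<psi>_def d_def e_def max_phase_spike)
  have far: "1 / 5 \<le> vnorm (\<phi> j - \<psi>)" if j: "j \<in> J" for j
  proof (rule states_far_apart[OF povm])
    have j': "0 < j" "j < N" using j by (auto simp: J_def)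
    show "\<not> (approx_mod_2pi \<delta> 0 x \<and> approx_mod_2pi \<delta> (3 * \<delta>) x)" for x
      by (rule approx_disjoint[OF \<delta>])
    show "\<phi> j \<in> carrier_vec (N * d)"
      using run_carrier[OF j gates e(1)] by (simp add: \<phi>_def)
    show "sqnorm (\<phi> j) = 1"
      using run_sqnorm[OF j gates e(1)] e by (simp add: \<phi>_def)
    have m: "max_phase N (spike j (3 * \<delta>)) = 3 * \<delta>"
      using j' \<delta> by (intro max_phase_spike) auto
    have "2 / 3 \<le> output_prob N alg (phase_unitary N (1\<^sub>m N) (spike j (3 * \<delta>))) (A j)
        (approx_mod_2pi \<delta> (max_phase N (spike j (3 * \<delta>))))"
    proof (rule correct[unfolded correct_on_def, rule_format])
      show "valid_phases N \<delta> (spike j (3 * \<delta>))"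
        \<comment> \<open>The promise asks for \<open>3 * \<delta> < 2 * pi - 2 * \<delta>\<close>,
          which follows from \<open>5 * \<delta> < 5\<close> and
          \<open>6 \<le> 2 * pi\<close>.\<close>
        using \<delta> pi_ge_three by (simp add: valid_phases_def m) (simp add: spike_def)
      show "valid_advice N \<gamma> (1\<^sub>m N) (spike j (3 * \<delta>)) (A j)"
        unfolding A_def using j' \<delta> cs by (intro valid_advice_rotation) auto
    qed
    moreover have "phase_unitary N (1\<^sub>m N) (spike j (3 * \<delta>)) = U j"
      by (simp add: phase_unitary_def spectral_mat_one U_def)
    ultimately show "2 / 3 \<le> povm_prob (povm alg) (approx_mod_2pi \<delta> (3 * \<delta>)) (\<phi> j)"
      by (simp add: prob m final_state_def \<phi>_def d_def e_def)
  qed (use \<psi> prob0 in auto)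
  define n where "n = real (card J)"
  \<comment> \<open>The factor 4 is a perfect square, which yields
    \<open>sqrt N \<le> 2 * sqrt n\<close> below.\<close>
  have n: "1 \<le> n" "real N \<le> 4 * n"
    using N by (auto simp: n_def J_def)
  have "n * (1 / 5) = (\<Sum>j\<in>J. 1 / 5)"
    by (simp add: n_def)
  also have "\<dots> \<le> (\<Sum>j\<in>J. vnorm (\<phi> j - \<psi>))"
    by (intro sum_mono far)
  also have "\<dots> \<le> (\<Sum>j\<in>J. vnorm (e - e)) + 3 * \<delta> * sqrt n * cost alg
      + 2 * \<gamma> * n * query_count Advice alg"
    \<comment> \<open>All runs start in the same state \<open>e\<close>, so the initial distances
      vanish.\<close>
    using hybrid[OF gates e(1), of "\<lambda>_. e"] e
    by (simp add: \<phi>_def \<psi>_def n_def query_count_def)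
  also have "vnorm (e - e) = 0"
    using e by (simp add: vnorm_def sqnorm_sum)
  also have "2 * \<gamma> * n * query_count Advice alg \<le> n * (1 / 10)"
  proof -
    have "\<gamma> * query_count Advice alg \<le> 1 / 20"
      using t t\<gamma> \<gamma> by (smt (verit) mult.commute mult_right_mono of_nat_le_iff)
    then have "2 * n * (\<gamma> * query_count Advice alg) \<le> 2 * n * (1 / 20)"
      using n by (intro mult_left_mono) auto
    then show ?thesis by (simp add: algebra_simps)
  qed
  finally have "n * (1 / 10) \<le> 3 * \<delta> * sqrt n * cost alg"
    by simp
  then have "sqrt n * sqrt n \<le> sqrt n * (30 * \<delta> * cost alg)"
    using n by (simp add: algebra_simps)
  then have "sqrt n \<le> 30 * \<delta> * cost alg"
    using n by (subst (asm) mult_le_cancel_left_pos) auto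
  moreover have "sqrt N \<le> 2 * sqrt n"
    using n by (intro real_le_lsqrt) (auto simp: power_mult_distrib)
  ultimately show ?thesis
    using \<delta> by (simp add: field_simps)
qed

theorem lemma3p5:
  fixes N t :: "nat \<Rightarrow> nat" and \<gamma> \<delta> :: "nat \<Rightarrow> real"
  assumes "\<And>n. n \<ge> 1 \<Longrightarrow> N n \<ge> 2"
    and "\<And>n. n \<ge> 1 \<Longrightarrow> 1 / sqrt (real (N n)) \<le> \<gamma> n \<and> \<gamma> n \<le> 1"
    and "\<And>n. n \<ge> 1 \<Longrightarrow> 0 < \<delta> n \<and> \<delta> n < 1"
    and "(\<lambda>n. real (t n) * \<gamma> n) \<longlonglongrightarrow> 0"
  shows "\<exists>c>0. \<exists>n0\<ge>1. \<forall>n\<ge>n0.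
           (\<forall>alg. solves_maxQPE_known (N n) (\<delta> n) (\<gamma> n) (t n) alg \<longrightarrow>
              c * sqrt (real (N n)) / \<delta> n \<le> real (cost alg)) \<and>
           (\<forall>alg. solves_maxQPE_unknown (N n) (\<delta> n) (\<gamma> n) (t n) alg \<longrightarrow>
              c * sqrt (real (N n)) / \<delta> n \<le> real (cost alg))"
proof -
  have "\<forall>\<^sub>F n in sequentially. real (t n) * \<gamma> n < 1 / 20"
    using assms(4) by (rule order_tendstoD) simp
  then obtain m where m: "\<And>n. n \<ge> m \<Longrightarrow> real (t n) * \<gamma> n < 1 / 20"
    by (auto simp: eventually_sequentially)
  have bound: "1 / 60 * sqrt (real (N n)) / \<delta> n \<le> real (cost alg)"
    if n: "n \<ge> max 1 m" and alg: "solves_maxQPE_known (N n) (\<delta> n) (\<gamma> n) (t n) alg" for n alg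
  proof (rule cost_lower_bound[OF _ _ _ _ _ _ alg])
    have "0 < 1 / sqrt (real (N n))"
      using assms(1)[of n] n by simp
    also have "\<dots> \<le> \<gamma> n"
      using assms(2)[of n] n by simp
    finally show "0 < \<gamma> n" .
  qed (use n assms(1-3)[of n] m[of n] in auto)
  \<comment> \<open>An algorithm for an unknown eigenbasis is in particular correct for the
    computational basis, given by the identity matrix.\<close>
  have known: "solves_maxQPE_known k \<delta> \<gamma> t alg" if "solves_maxQPE_unknown k \<delta> \<gamma> t alg" for k \<delta> \<gamma> t alg
    using that by (simp add: solves_maxQPE_known_def solves_maxQPE_unknown_def)
  show ?thesis
  proof (intro exI[of _ "1 / 60"] exI[of _ "max 1 m"] conjI allI impI)
    fix n alg assume n: "n \<ge> max 1 m"
    show "1 / 60 * sqrt (real (N n)) / \<delta> n \<le> real (cost alg)"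
      if "solves_maxQPE_known (N n) (\<delta> n) (\<gamma> n) (t n) alg"
      using bound[OF n that] .
    show "1 / 60 * sqrt (real (N n)) / \<delta> n \<le> real (cost alg)"
      if "solves_maxQPE_unknown (N n) (\<delta> n) (\<gamma> n) (t n) alg"
      using bound[OF n known[OF that]] .
  qed auto
qed

end
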